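(* Suppose that $\sup_{z_1,z_2\in Z}V(z_1,z_2)\le\Omega_Z^2$. If the parameters $\{\alpha_t\}$ and $\{\gamma_t\}$ in the AMP method are set to $$\alpha_t=\frac2{t+1}\quad\text{and}\quad\gamma_t=\frac{\mu t}{2(L_G+L_Ht)},\qquad t\ge1,$$ (where $L_G+L_H>0$), then for all $t\ge1$ and all $u\in Z$, $$Q(w^{ag}_{t+1},u)\le\left(\frac{4L_G}{\mu t(t+1)}+\frac{4L_H}{\mu t}\right)\Omega_Z^2 .$$
   Context: Setting. $\mathcal E$ is a finite-dimensional real vector space with inner product $\langle\cdot,\cdot\rangle$ and a norm $\|\cdot\|$, with dual norm $\|\eta\|_*=\sup_{\|x\|\le1}\langle\eta,x\rangle$; $Z\subset\mathcal E$ is a nonempty closed convex set. $G$ is continuously differentiable with $0\le G(w)-G(v)-\langle\nabla G(v),w-v\rangle\le\frac{L_G}{2}\|w-v\|^2$ for all $w,v\in Z$. $H:Z\to\mathcal E$ satisfies $\langle H(w)-H(v),w-v\rangle\ge0$ and $\|H(w)-H(v)\|_*\le L_H\|w-v\|$ for all $w,v\in Z$. $J$ is a real-valued convex function on $Z$ having a subgradient $J'(u)\in\partial J(u)$ at each $u\in Z$. Prox-mapping. $\omega$ is a differentiable strongly convex function on $Z$ with convexity parameter $\mu>0$ with respect to $\|\cdot\|$; $V(z,u)=\omega(u)-\omega(z)-\langle\nabla\omega(z),u-z\rangle$ for $u,z\in Z$. For $z\in Z$, $\eta\in\mathcal E$, $\gamma>0$, $P_z^{\gamma J}(\eta)=\operatorname{argmin}_{u\in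 Z}\{\langle\eta,u-z\rangle+V(z,u)+\gamma J(u)\}$, assumed to be well defined. AMP method. Choose $r_1\in Z$ and set $w_1=w_1^{ag}=r_1$. For $t=1,2,\ldots$: $w_t^{md}=(1-\alpha_t)w_t^{ag}+\alpha_tr_t$; $w_{t+1}=P_{r_t}^{\gamma_tJ}(\gamma_tH(r_t)+\gamma_t\nabla G(w_t^{md}))$; $r_{t+1}=P_{r_t}^{\gamma_tJ}(\gamma_tH(w_{t+1})+\gamma_t\nabla G(w_t^{md}))$; $w_{t+1}^{ag}=(1-\alpha_t)w_t^{ag}+\alpha_tw_{t+1}$. $Q(\tilde u,u)=G(\tilde u)-G(u)+\langle H(u),\tilde u-u\rangle+J(\tilde u)-J(u)$ for $\tilde u,u\in Z$. *)

theory Defs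
  imports "HOL-Analysis.Analysis"
begin

text \<open>The ambient space is a type of class \<open>euclidean_space\<close>, which supplies the inner product.
  The norm of the setting is a separate function \<open>N\<close>, unrelated to the Euclidean norm.\<close>

definition is_norm :: "('a::real_vector \<Rightarrow> real) \<Rightarrow> bool" where
  "is_norm N \<longleftrightarrow>
     (\<forall>x. 0 \<le> N x) \<and>
     (\<forall>x. N x = 0 \<longleftrightarrow> x = 0) \<and>
     (\<forall>c x. N (c *\<^sub>R x) = \<bar>c\<bar> * N x) \<and>
     (\<forall>x y. N (x + y) \<le> N x + N y)"

definition dual_norm :: "('a::real_inner \<Rightarrow> real) \<Rightarrow> 'a \<Rightarrow> real" where
  "dual_norm N \<eta> = (SUP x\<in>{x. N x \<le> 1}. \<eta> \<bullet> x)"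

text \<open>Derivatives are taken within \<open>Z\<close>, so that functions defined only on \<open>Z\<close> are covered.
  If \<open>Z\<close> has empty interior, \<open>gradf\<close> is not unique, but for convex \<open>Z\<close> the products
  \<open>gradf v \<bullet> (x - y)\<close> with \<open>x, y \<in> Z\<close>, the only ones used below, do not depend on
  the choice.\<close>

definition has_gradient_on :: "('a::real_inner \<Rightarrow> real) \<Rightarrow> ('a \<Rightarrow> 'a) \<Rightarrow> 'a set \<Rightarrow> bool" where
  "has_gradient_on f gradf Z \<longleftrightarrow>
     (\<forall>v\<in>Z. (f has_derivative (\<lambda>h. gradf v \<bullet> h)) (at v within Z))"

definition subdifferential :: "'a::real_inner set \<Rightarrow> ('a \<Rightarrow> real) \<Rightarrow> 'a \<Rightarrow> 'a set" where
  "subdifferential Z J u = {g. \<forall>v\<in>Z. J u + g \<bullet> (v - u) \<le> J v}"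

definition strongly_convex_on ::
    "('a::real_vector \<Rightarrow> real) \<Rightarrow> real \<Rightarrow> 'a set \<Rightarrow> ('a \<Rightarrow> real) \<Rightarrow> bool" where
  "strongly_convex_on N \<mu> Z f \<longleftrightarrow> convex Z \<and>
     (\<forall>x\<in>Z. \<forall>y\<in>Z. \<forall>s\<in>{0..1}.
        f ((1 - s) *\<^sub>R x + s *\<^sub>R y)
          \<le> (1 - s) * f x + s * f y - \<mu> / 2 * s * (1 - s) * (N (x - y))\<^sup>2)"

definition bregman :: "('a::real_inner \<Rightarrow> real) \<Rightarrow> ('a \<Rightarrow> 'a) \<Rightarrow> 'a \<Rightarrow> 'a \<Rightarrow> real" where
  "bregman \<omega> grad\<omega> z u = \<omega> u - \<omega> z - grad\<omega> z \<bullet> (u - z)"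

definition prox_objective ::
    "('a::real_inner \<Rightarrow> real) \<Rightarrow> ('a \<Rightarrow> 'a) \<Rightarrow> ('a \<Rightarrow> real) \<Rightarrow> real \<Rightarrow> 'a \<Rightarrow> 'a \<Rightarrow> 'a \<Rightarrow> real" where
  "prox_objective \<omega> grad\<omega> J \<gamma> z \<eta> u = \<eta> \<bullet> (u - z) + bregman \<omega> grad\<omega> z u + \<gamma> * J u"

text \<open>\<open>arg_min_on\<close> is a choice operator; \<open>prox\<close> is meaningful under \<open>prox_well_defined\<close>.\<close>

definition prox ::
    "'a::real_inner set \<Rightarrow> ('a \<Rightarrow> real) \<Rightarrow> ('a \<Rightarrow> 'a) \<Rightarrow> ('a \<Rightarrow> real) \<Rightarrow> real \<Rightarrow> 'a \<Rightarrow> 'a \<Rightarrow> 'a" where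
  "prox Z \<omega> grad\<omega> J \<gamma> z \<eta> = arg_min_on (prox_objective \<omega> grad\<omega> J \<gamma> z \<eta>) Z"

definition prox_well_defined ::
    "'a::real_inner set \<Rightarrow> ('a \<Rightarrow> real) \<Rightarrow> ('a \<Rightarrow> 'a) \<Rightarrow> ('a \<Rightarrow> real) \<Rightarrow> bool" where
  "prox_well_defined Z \<omega> grad\<omega> J \<longleftrightarrow>
     (\<forall>z\<in>Z. \<forall>\<eta>. \<forall>\<gamma>>0.
        \<exists>!u. is_arg_min (prox_objective \<omega> grad\<omega> J \<gamma> z \<eta>) (\<lambda>u. u \<in> Z) u)"

text \<open>All sequences are indexed from 1; their values at 0 are irrelevant.\<close>

definition amp_method ::
    "'a::real_inner set \<Rightarrow> ('a \<Rightarrow> 'a) \<Rightarrow> ('a \<Rightarrow> 'a) \<Rightarrow> ('a \<Rightarrow> real) \<Rightarrow>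
     ('a \<Rightarrow> real) \<Rightarrow> ('a \<Rightarrow> 'a) \<Rightarrow> (nat \<Rightarrow> real) \<Rightarrow> (nat \<Rightarrow> real) \<Rightarrow>
     (nat \<Rightarrow> 'a) \<Rightarrow> (nat \<Rightarrow> 'a) \<Rightarrow> (nat \<Rightarrow> 'a) \<Rightarrow> (nat \<Rightarrow> 'a) \<Rightarrow> bool" where
  "amp_method Z gradG H J \<omega> grad\<omega> \<alpha> \<gamma> r w w_md w_ag \<longleftrightarrow>
     r 1 \<in> Z \<and> w 1 = r 1 \<and> w_ag 1 = r 1 \<and>
     (\<forall>t\<ge>1.
        w_md t = (1 - \<alpha> t) *\<^sub>R w_ag t + \<alpha> t *\<^sub>R r t \<and>
        w (t + 1) = prox Z \<omega> grad\<omega> J (\<gamma> t) (r t)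
                      (\<gamma> t *\<^sub>R H (r t) + \<gamma> t *\<^sub>R gradG (w_md t)) \<and>
        r (t + 1) = prox Z \<omega> grad\<omega> J (\<gamma> t) (r t)
                      (\<gamma> t *\<^sub>R H (w (t + 1)) + \<gamma> t *\<^sub>R gradG (w_md t)) \<and>
        w_ag (t + 1) = (1 - \<alpha> t) *\<^sub>R w_ag t + \<alpha> t *\<^sub>R w (t + 1))"

definition gap ::
    "('a::real_inner \<Rightarrow> real) \<Rightarrow> ('a \<Rightarrow> 'a) \<Rightarrow> ('a \<Rightarrow> real) \<Rightarrow> 'a \<Rightarrow> 'a \<Rightarrow> real" where
  "gap G H J u' u = G u' - G u + H u \<bullet> (u' - u) + J u' - J u"

end

theory Submission
  imports Defs
begin

text \<open>Adding the optimality inequalities of the two prox-steps, and absorbing the cross term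
  \<open>\<gamma> \<langle>H w - H r, w - r'\<rangle>\<close> into the Bregman distances by strong convexity and
  Lipschitz continuity of \<open>H\<close>, shows that one step changes the gap at \<open>w_ag\<close> by
  \<open>gap' \<le> (1 - \<alpha>) gap + \<alpha> / \<gamma> (V(r, u) - V(r', u))\<close>.
  With the given parameters the weights \<open>t (t + 1) / 2\<close> make the gap terms telescope, while the
  coefficients \<open>2 (L_G + L_H t) / \<mu>\<close> of the Bregman distances are nondecreasing in \<open>t\<close>, so
  Abel summation and \<open>V \<le> \<Omega>_Z\<^sup>2\<close> bound the total.\<close>

section \<open>Norms and dual norms in finite dimension\<close>

text \<open>Serves to make \<open>N\<close> continuous, since a convex function on an open set of a
  Euclidean space is continuous.\<close>

lemma is_norm_convex:
  fixes N :: "'a::euclidean_space \<Rightarrow> real"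
  assumes N: "is_norm N"
  shows "convex_on UNIV N"
proof (rule convex_onI)
  fix t :: real and x y :: 'a
  assume t: "0 < t" "t < 1"
  have "N ((1 - t) *\<^sub>R x + t *\<^sub>R y) \<le> N ((1 - t) *\<^sub>R x) + N (t *\<^sub>R y)"
    using N unfolding is_norm_def by blast
  also have "\<dots> = (1 - t) * N x + t * N y"
    using N t unfolding is_norm_def by simp
  finally show "N ((1 - t) *\<^sub>R x + t *\<^sub>R y) \<le> (1 - t) * N x + t * N y" .
qed simp

text \<open>By compactness, \<open>N\<close> attains its minimum on the Euclidean unit sphere. The
  minimum is positive because \<open>N\<close> vanishes only at 0, and homogeneity carries the bound
  to all vectors.\<close>

lemma is_norm_lower_bound:
  fixes N :: "'a::euclidean_space \<Rightarrow> real"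
  assumes N: "is_norm N"
  obtains c where "0 < c" "\<And>x. c * norm x \<le> N x"
proof -
  have "continuous_on (sphere 0 1) N"
    using convex_on_continuous[OF open_UNIV is_norm_convex[OF N]] continuous_on_subset by blast
  moreover have "sphere (0::'a) 1 \<noteq> {}" by simp
  ultimately obtain e where e: "e \<in> sphere 0 1" "\<And>y. y \<in> sphere 0 1 \<Longrightarrow> N e \<le> N y"
    using continuous_attains_inf[OF compact_sphere] by metis
  from e(1) have "e \<noteq> 0" by auto
  then have "0 < N e" using N unfolding is_norm_def by (metis less_eq_real_def)
  moreover have "N e * norm x \<le> N x" for x
  proof (cases "x = 0")
    case True
    then show ?thesis using N unfolding is_norm_def by simp
  next
    case False
    have "N e \<le> N (inverse (norm x) *\<^sub>R x)" using False by (intro e(2)) simp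
    also have "\<dots> = inverse (norm x) * N x" using N unfolding is_norm_def by simp
    finally show ?thesis using False by (simp add: field_simps)
  qed
  ultimately show thesis using that by blast
qed

text \<open>Scaling \<open>x\<close> to \<open>N\<close>-length 1 makes it a competitor in the
  supremum. A real-valued \<open>SUP\<close> is an upper bound only for a bounded set, so the
  \<open>N\<close>-unit ball is first shown to be bounded in the Euclidean norm.\<close>

lemma inner_le_dual_norm:
  fixes N :: "'a::euclidean_space \<Rightarrow> real"
  assumes N: "is_norm N"
  shows "\<eta> \<bullet> x \<le> dual_norm N \<eta> * N x"
proof (cases "x = 0")
  case True
  then have "N x = 0" using N unfolding is_norm_def by blast
  with True show ?thesis by simp
next
  case False
  then have pos: "0 < N x" using N unfolding is_norm_def by (metis less_eq_real_def)
  obtain c where c: "0 < c" "\<And>x. c * norm x \<le> N x" using is_norm_lower_bound[OF N] by blast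
  have "bdd_above ((\<lambda>x. \<eta> \<bullet> x) ` {x. N x \<le> 1})"
  proof (rule bdd_aboveI2)
    fix y assume "y \<in> {x. N x \<le> 1}"
    then have "c * norm y \<le> 1" using c(2)[of y] by simp
    then have "norm y \<le> 1 / c" using c(1) by (simp add: field_simps)
    then show "\<eta> \<bullet> y \<le> norm \<eta> * (1 / c)"
      by (meson norm_cauchy_schwarz mult_left_mono norm_ge_zero order_trans)
  qed
  moreover have "inverse (N x) *\<^sub>R x \<in> {x. N x \<le> 1}"
  proof -
    have "N (inverse (N x) *\<^sub>R x) = \<bar>inverse (N x)\<bar> * N x" using N unfolding is_norm_def by blast
    then show ?thesis using pos by simp
  qed
  ultimately have "\<eta> \<bullet> (inverse (N x) *\<^sub>R x) \<le> dual_norm N \<eta>"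
    unfolding dual_norm_def by (rule cSUP_upper[rotated])
  then show ?thesis using pos by (simp add: field_simps)
qed

lemma is_norm_minus_commute: "is_norm N \<Longrightarrow> N (x - y) = N (y - x)"
proof -
  assume "is_norm N"
  then have "N ((-1) *\<^sub>R (y - x)) = \<bar>-1\<bar> * N (y - x)" unfolding is_norm_def by blast
  then show ?thesis by simp
qed

section \<open>Directional derivatives and Bregman distances\<close>

text \<open>Chain rule along the segment from \<open>z\<close> to \<open>u\<close>. The segment
  stays in \<open>Z\<close> for \<open>s\<close> in \<open>{0..1}\<close>, so a derivative within
  \<open>Z\<close> suffices; it yields a one-sided limit, as \<open>Z\<close> may end at
  \<open>z\<close>.\<close>

lemma has_gradient_on_directional:
  assumes f: "has_gradient_on f g Z" and Z: "convex Z" and zu: "z \<in> Z" "u \<in> Z"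
  shows "((\<lambda>s. (f (z + s *\<^sub>R (u - z)) - f z) / s) \<longlongrightarrow> g z \<bullet> (u - z)) (at_right 0)"
proof -
  define p where "p s = z + s *\<^sub>R (u - z)" for s
  have p01: "p ` {0..1} \<subseteq> Z"
  proof
    fix y assume "y \<in> p ` {0..1}"
    then obtain s where "s \<in> {0..1}" "y = (1 - s) *\<^sub>R z + s *\<^sub>R u"
      unfolding p_def by (auto simp: algebra_simps)
    then show "y \<in> Z" using Z zu by (auto intro: convexD)
  qed
  have "(p has_derivative (\<lambda>h. h *\<^sub>R (u - z))) (at 0 within {0..1})"
    unfolding p_def by (auto intro!: derivative_eq_intros)
  moreover have "(f has_derivative (\<lambda>h. g z \<bullet> h)) (at (p 0) within p ` {0..1})"
    using f zu(1) unfolding has_gradient_on_def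
    by (intro has_derivative_subset[OF _ p01]) (simp add: p_def)
  ultimately have "(f \<circ> p has_derivative (\<lambda>h. g z \<bullet> h) \<circ> (\<lambda>h. h *\<^sub>R (u - z))) (at 0 within {0..1})"
    by (rule diff_chain_within)
  then have "((f \<circ> p) has_field_derivative g z \<bullet> (u - z)) (at 0 within {0..1})"
    by (simp add: has_field_derivative_def o_def mult_commute_abs)
  then have "((\<lambda>s. ((f \<circ> p) s - (f \<circ> p) 0) / (s - 0)) \<longlongrightarrow> g z \<bullet> (u - z)) (at 0 within {0..1})"
    unfolding has_field_derivative_iff .
  moreover have "at (0::real) within {0..1} = at_right 0"
    by (rule at_within_Icc_at_right) simp
  ultimately show ?thesis by (simp add: p_def o_def)
qed

text \<open>Strong convexity on the segment, divided by \<open>s\<close>, bounds the difference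
  quotient of \<open>\<omega>\<close>. As \<open>s\<close> tends to 0 from the right, the quotient
  tends to the gradient term and the factor \<open>1 - s\<close> to 1.\<close>

lemma bregman_lower_bound:
  assumes \<omega>: "has_gradient_on \<omega> g Z" "strongly_convex_on N \<mu> Z \<omega>"
    and zu: "z \<in> Z" "u \<in> Z"
  shows "\<mu> / 2 * (N (z - u))\<^sup>2 \<le> bregman \<omega> g z u"
proof -
  define K where "K = \<mu> / 2 * (N (z - u))\<^sup>2"
  have Z: "convex Z" using \<omega>(2) unfolding strongly_convex_on_def by blast
  have "\<forall>\<^sub>F s in at_right (0::real). s \<in> {0<..<1}"
    by (rule eventually_at_right_real) simp
  then have "\<forall>\<^sub>F s in at_right 0.
      (\<omega> (z + s *\<^sub>R (u - z)) - \<omega> z) / s \<le> \<omega> u - \<omega> z - (1 - s) * K"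
  proof eventually_elim
    case (elim s)
    then have "\<omega> ((1 - s) *\<^sub>R z + s *\<^sub>R u)
        \<le> (1 - s) * \<omega> z + s * \<omega> u - \<mu> / 2 * s * (1 - s) * (N (z - u))\<^sup>2"
      using \<omega>(2) zu unfolding strongly_convex_on_def by simp
    moreover have "(1 - s) *\<^sub>R z + s *\<^sub>R u = z + s *\<^sub>R (u - z)" by (simp add: algebra_simps)
    ultimately have "\<omega> (z + s *\<^sub>R (u - z)) - \<omega> z \<le> s * (\<omega> u - \<omega> z - (1 - s) * K)"
      unfolding K_def by (simp add: algebra_simps)
    then show ?case using elim by (simp add: divide_le_eq mult.commute)
  qed
  moreover have "((\<lambda>s. \<omega> u - \<omega> z - (1 - s) * K) \<longlongrightarrow> \<omega> u - \<omega> z - (1 - 0) * K) (at_right 0)"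
    by (intro tendsto_intros)
  ultimately have "g z \<bullet> (u - z) \<le> \<omega> u - \<omega> z - (1 - 0) * K"
    using has_gradient_on_directional[OF \<omega>(1) Z zu]
    by (intro tendsto_le[of "at_right 0"]) auto
  then show ?thesis unfolding K_def bregman_def by simp
qed

section \<open>The prox-mapping\<close>

lemma prox_is_arg_min:
  assumes "prox_well_defined Z \<omega> g J" "z \<in> Z" "0 < \<gamma>"
  shows "is_arg_min (prox_objective \<omega> g J \<gamma> z \<eta>) (\<lambda>u. u \<in> Z) (prox Z \<omega> g J \<gamma> z \<eta>)"
  using assms unfolding prox_well_defined_def prox_def arg_min_on_def arg_min_def
  by (metis (no_types, lifting) someI_ex)

lemma prox_in:
  assumes "prox_well_defined Z \<omega> g J" "z \<in> Z" "0 < \<gamma>"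
  shows "prox Z \<omega> g J \<gamma> z \<eta> \<in> Z"
  using prox_is_arg_min[OF assms] unfolding is_arg_min_def by blast

text \<open>First-order optimality of \<open>p\<close>, tested along the segment towards
  \<open>u\<close>. Since \<open>J\<close> is only convex, it is replaced by its chord, which is
  linear in \<open>s\<close>. The result becomes the claim through the identity
  \<open>V(z,u) - V(z,p) - V(p,u) = (g p - g z) \<bullet> (u - p)\<close>.\<close>

lemma prox_three_point:
  assumes \<omega>: "has_gradient_on \<omega> g Z" and J: "convex_on Z J"
    and wd: "prox_well_defined Z \<omega> g J" and z: "z \<in> Z" and \<gamma>: "0 < \<gamma>" and u: "u \<in> Z"
    and p_def: "p = prox Z \<omega> g J \<gamma> z \<eta>"
  shows "\<gamma> * J p + \<eta> \<bullet> (p - u) + bregman \<omega> g z p + bregman \<omega> g p u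
           \<le> \<gamma> * J u + bregman \<omega> g z u"
proof -
  have Z: "convex Z" using J by (rule convex_on_imp_convex)
  have p: "p \<in> Z" unfolding p_def by (rule prox_in[OF wd z \<gamma>])
  \<comment> \<open>All slopes other than that of \<open>\<omega>\<close> are collected in
    \<open>K\<close>, so optimality bounds the difference quotients of \<open>\<omega>\<close> at
    \<open>p\<close> below by a constant.\<close>
  define K where "K = g z \<bullet> (u - p) - \<eta> \<bullet> (u - p) - \<gamma> * (J u - J p)"
  have "\<forall>\<^sub>F s in at_right (0::real). s \<in> {0<..<1}"
    by (rule eventually_at_right_real) simp
  then have "\<forall>\<^sub>F s in at_right 0. K \<le> (\<omega> (p + s *\<^sub>R (u - p)) - \<omega> p) / s"
  proof eventually_elim
    case (elim s)
    define q where "q = p + s *\<^sub>R (u - p)"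
    have q: "q = (1 - s) *\<^sub>R p + s *\<^sub>R u" unfolding q_def by (simp add: algebra_simps)
    have "q \<in> Z" unfolding q using Z p u elim by (auto intro: convexD)
    then have "prox_objective \<omega> g J \<gamma> z \<eta> p \<le> prox_objective \<omega> g J \<gamma> z \<eta> q"
      using prox_is_arg_min[OF wd z \<gamma>] unfolding p_def is_arg_min_linorder by blast
    then have "\<eta> \<bullet> p + \<omega> p - g z \<bullet> p + \<gamma> * J p \<le> \<eta> \<bullet> q + \<omega> q - g z \<bullet> q + \<gamma> * J q"
      unfolding prox_objective_def bregman_def by (simp add: inner_diff_right)
    moreover have "J q \<le> (1 - s) * J p + s * J u"
      unfolding q using convex_onD[OF J, of s p u] p u elim by simp
    then have "\<gamma> * J q \<le> \<gamma> * ((1 - s) * J p + s * J u)" using \<gamma> by simp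
    ultimately have "\<eta> \<bullet> p + \<omega> p - g z \<bullet> p + \<gamma> * J p
        \<le> \<eta> \<bullet> q + \<omega> q - g z \<bullet> q + \<gamma> * ((1 - s) * J p + s * J u)"
      by linarith
    then have "s * K \<le> \<omega> q - \<omega> p"
      unfolding K_def q_def
      by (simp add: inner_diff_right inner_add_right algebra_simps)
    then show ?case using elim unfolding q_def by (simp add: le_divide_eq mult.commute)
  qed
  then have "K \<le> g p \<bullet> (u - p)"
    using has_gradient_on_directional[OF \<omega> Z p u]
    by (intro tendsto_lowerbound[of _ _ "at_right 0"]) auto
  then show ?thesis
    unfolding K_def bregman_def by (simp add: inner_diff_right algebra_simps)
qed

section \<open>One step of the method\<close>

text \<open>The hypothesis \<open>step\<close> balances the multiples of \<open>d\<^sup>2\<close>,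
  where \<open>d = N (w - r)\<close>: strong convexity supplies \<open>\<mu> / 2\<close>, the cross
  term in \<open>H\<close> consumes \<open>L_H\<^sup>2 * \<gamma>\<^sup>2 / (2 * \<mu>)\<close>, and
  the upper bound on \<open>G\<close> consumes \<open>L_G * a * \<gamma> / 2\<close>.\<close>

lemma gap_step:
  fixes N :: "'a::euclidean_space \<Rightarrow> real"
  assumes N: "is_norm N" and Z: "convex Z"
    and J: "convex_on Z J"
    and \<omega>: "has_gradient_on \<omega> grad\<omega> Z" "strongly_convex_on N \<mu> Z \<omega>"
    and wd: "prox_well_defined Z \<omega> grad\<omega> J"
    and \<mu>: "0 < \<mu>" and \<gamma>: "0 < \<gamma>" and a: "0 \<le> a" "a \<le> 1"
    and step: "L_G * a * \<gamma> + L_H\<^sup>2 * \<gamma>\<^sup>2 / \<mu> \<le> \<mu>"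
    and in_Z: "r \<in> Z" "ag \<in> Z" "u \<in> Z"
    and md: "md = (1 - a) *\<^sub>R ag + a *\<^sub>R r"
    and w: "w = prox Z \<omega> grad\<omega> J \<gamma> r (\<gamma> *\<^sub>R H r + \<gamma> *\<^sub>R gradG md)"
    and r': "r' = prox Z \<omega> grad\<omega> J \<gamma> r (\<gamma> *\<^sub>R H w + \<gamma> *\<^sub>R gradG md)"
    and ag': "ag' = (1 - a) *\<^sub>R ag + a *\<^sub>R w"
    and G: "\<And>x v. x \<in> Z \<Longrightarrow> v \<in> Z \<Longrightarrow>
          0 \<le> G x - G v - gradG v \<bullet> (x - v) \<and>
          G x - G v - gradG v \<bullet> (x - v) \<le> L_G / 2 * (N (x - v))\<^sup>2"
    and H_mono: "\<And>x v. x \<in> Z \<Longrightarrow> v \<in> Z \<Longrightarrow> 0 \<le> (H x - H v) \<bullet> (x - v)"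
    and H_Lip: "\<And>x v. x \<in> Z \<Longrightarrow> v \<in> Z \<Longrightarrow> dual_norm N (H x - H v) \<le> L_H * N (x - v)"
  shows "gap G H J ag' u
           \<le> (1 - a) * gap G H J ag u + a / \<gamma> * (bregman \<omega> grad\<omega> r u - bregman \<omega> grad\<omega> r' u)"
proof -
  define d where "d = N (w - r)"
  define e where "e = N (w - r')"
  have wZ: "w \<in> Z" and r'Z: "r' \<in> Z" unfolding w r' by (rule prox_in[OF wd in_Z(1) \<gamma>])+
  have mdZ: "md \<in> Z" and ag'Z: "ag' \<in> Z"
    unfolding md ag' using Z in_Z wZ a by (auto intro: convexD)

  \<comment> \<open>The first prox-step is tested at \<open>r'\<close> and only the second at
    \<open>u\<close>, so \<open>\<gamma> * J r'\<close> and \<open>V(r,r')\<close> cancel when the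
    two inequalities are added.\<close>
  have prox1: "\<gamma> * J w + (\<gamma> *\<^sub>R H r + \<gamma> *\<^sub>R gradG md) \<bullet> (w - r') + bregman \<omega> grad\<omega> r w
      + bregman \<omega> grad\<omega> w r' \<le> \<gamma> * J r' + bregman \<omega> grad\<omega> r r'"
    by (rule prox_three_point[OF \<omega>(1) J wd in_Z(1) \<gamma> r'Z w])
  have prox2: "\<gamma> * J r' + (\<gamma> *\<^sub>R H w + \<gamma> *\<^sub>R gradG md) \<bullet> (r' - u) + bregman \<omega> grad\<omega> r r'
      + bregman \<omega> grad\<omega> r' u \<le> \<gamma> * J u + bregman \<omega> grad\<omega> r u"
    by (rule prox_three_point[OF \<omega>(1) J wd in_Z(1) \<gamma> in_Z(3) r'])
  have V1: "\<mu> / 2 * d\<^sup>2 \<le> bregman \<omega> grad\<omega> r w"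
    using bregman_lower_bound[OF \<omega> in_Z(1) wZ] is_norm_minus_commute[OF N] unfolding d_def by metis
  have V2: "\<mu> / 2 * e\<^sup>2 \<le> bregman \<omega> grad\<omega> w r'"
    using bregman_lower_bound[OF \<omega> wZ r'Z] unfolding e_def .
  have "(H w - H r) \<bullet> (w - r') \<le> dual_norm N (H w - H r) * e"
    unfolding e_def by (rule inner_le_dual_norm[OF N])
  also have "\<dots> \<le> L_H * d * e"
    unfolding d_def using H_Lip[OF wZ in_Z(1)] N
    by (intro mult_right_mono) (simp_all add: e_def is_norm_def)
  finally have "\<gamma> * ((H w - H r) \<bullet> (w - r')) \<le> \<gamma> * (L_H * d * e)" using \<gamma> by simp
  \<comment> \<open>Young's inequality, weighted so that the term in \<open>e\<close> is exactly the
    one covered by \<open>V2\<close>.\<close>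
  also have "\<dots> \<le> L_H\<^sup>2 * \<gamma>\<^sup>2 / (2 * \<mu>) * d\<^sup>2 + \<mu> / 2 * e\<^sup>2"
  proof -
    have "0 \<le> (L_H * \<gamma> * d - \<mu> * e)\<^sup>2 / (2 * \<mu>)" using \<mu> by simp
    also have "\<dots> = L_H\<^sup>2 * \<gamma>\<^sup>2 / (2 * \<mu>) * d\<^sup>2 + \<mu> / 2 * e\<^sup>2 - \<gamma> * (L_H * d * e)"
      using \<mu> by (simp add: field_simps power2_eq_square)
    finally show ?thesis by simp
  qed
  finally have cross: "\<gamma> * ((H w - H r) \<bullet> (w - r'))
      \<le> L_H\<^sup>2 * \<gamma>\<^sup>2 / (2 * \<mu>) * d\<^sup>2 + \<mu> / 2 * e\<^sup>2" .
  have "0 \<le> \<gamma> * ((H w - H u) \<bullet> (w - u))" using H_mono[OF wZ in_Z(3)] \<gamma> by simp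
  \<comment> \<open>Writing \<open>r' - u\<close> as \<open>(w - u) - (w - r')\<close> isolates the
    cross term. Passing from \<open>H w\<close> to \<open>H u\<close> leaves a monotonicity term of
    favourable sign.\<close>
  moreover have "(\<gamma> *\<^sub>R H r + \<gamma> *\<^sub>R gradG md) \<bullet> (w - r') + (\<gamma> *\<^sub>R H w + \<gamma> *\<^sub>R gradG md) \<bullet> (r' - u)
      = \<gamma> * ((H u + gradG md) \<bullet> (w - u)) + \<gamma> * ((H w - H u) \<bullet> (w - u))
        - \<gamma> * ((H w - H r) \<bullet> (w - r'))"
    by (simp add: inner_diff_left inner_diff_right inner_add_left algebra_simps)
  ultimately have "\<gamma> * (J w - J u + (H u + gradG md) \<bullet> (w - u))
      \<le> bregman \<omega> grad\<omega> r u - bregman \<omega> grad\<omega> r' u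
        - (\<mu> / 2 - L_H\<^sup>2 * \<gamma>\<^sup>2 / (2 * \<mu>)) * d\<^sup>2"
    using prox1 prox2 V1 V2 cross by (simp add: algebra_simps)
  moreover have "L_G * a * \<gamma> / 2 * d\<^sup>2 \<le> (\<mu> / 2 - L_H\<^sup>2 * \<gamma>\<^sup>2 / (2 * \<mu>)) * d\<^sup>2"
    using step by (intro mult_right_mono) (simp_all add: field_simps)
  moreover have "\<gamma> * (J w - J u + (H u + gradG md) \<bullet> (w - u) + L_G * a / 2 * d\<^sup>2)
      = \<gamma> * (J w - J u + (H u + gradG md) \<bullet> (w - u)) + L_G * a * \<gamma> / 2 * d\<^sup>2"
    by (simp add: distrib_left mult_ac)
  ultimately have "\<gamma> * (J w - J u + (H u + gradG md) \<bullet> (w - u) + L_G * a / 2 * d\<^sup>2)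
      \<le> bregman \<omega> grad\<omega> r u - bregman \<omega> grad\<omega> r' u"
    by linarith
  then have "J w - J u + (H u + gradG md) \<bullet> (w - u) + L_G * a / 2 * d\<^sup>2
      \<le> (bregman \<omega> grad\<omega> r u - bregman \<omega> grad\<omega> r' u) / \<gamma>"
    using \<gamma> by (simp add: le_divide_eq mult.commute)
  then have main: "a * (J w - J u + (H u + gradG md) \<bullet> (w - u) + L_G * a / 2 * d\<^sup>2)
      \<le> a / \<gamma> * (bregman \<omega> grad\<omega> r u - bregman \<omega> grad\<omega> r' u)"
    using mult_left_mono[OF _ a(1)] by fastforce

  \<comment> \<open>Both points share the part \<open>(1 - a) *\<^sub>R ag\<close>, so the quadratic
    error of \<open>G\<close> carries \<open>a\<^sup>2\<close>: one factor \<open>a\<close> is the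
    weight in \<open>main\<close>, the other enters \<open>step\<close>.\<close>
  have diff: "ag' - md = a *\<^sub>R (w - r)" unfolding ag' md by (simp add: algebra_simps)
  have "N (ag' - md) = a * d"
    unfolding diff d_def using N a unfolding is_norm_def by simp
  then have G1: "G ag' \<le> G md + gradG md \<bullet> (ag' - md) + L_G / 2 * (a * d)\<^sup>2"
    using G[OF ag'Z mdZ] by simp
  \<comment> \<open>Splitting off \<open>ag - md\<close> and \<open>u - md\<close> lets the lower
    bounds on \<open>G\<close> at \<open>ag\<close> and \<open>u\<close> remove the linearization at
    \<open>md\<close>, leaving only its product with \<open>w - u\<close>.\<close>
  have "ag' - md = (1 - a) *\<^sub>R (ag - md) + a *\<^sub>R (w - u) + a *\<^sub>R (u - md)"
    unfolding ag' by (simp add: algebra_simps)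
  then have G2: "gradG md \<bullet> (ag' - md) = (1 - a) * (gradG md \<bullet> (ag - md))
      + a * (gradG md \<bullet> (w - u)) + a * (gradG md \<bullet> (u - md))"
    by (simp add: inner_add_right)
  have G3: "(1 - a) * (G md + gradG md \<bullet> (ag - md)) \<le> (1 - a) * G ag"
    using G[OF in_Z(2) mdZ] a by (intro mult_left_mono) auto
  have G4: "a * (G md + gradG md \<bullet> (u - md)) \<le> a * G u"
    using G[OF in_Z(3) mdZ] a by (intro mult_left_mono) auto
  have G5: "G ag' \<le> (1 - a) * G ag + a * G u + a * (gradG md \<bullet> (w - u)) + L_G / 2 * (a * d)\<^sup>2"
    using G1 G2 G3 G4 by (simp add: algebra_simps)
  have J1: "J ag' \<le> (1 - a) * J ag + a * J w"
    unfolding ag' using convex_onD[OF J, of a ag w] in_Z wZ a by simp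
  have "ag' - u = (1 - a) *\<^sub>R (ag - u) + a *\<^sub>R (w - u)"
    unfolding ag' by (simp add: algebra_simps)
  then have H1: "H u \<bullet> (ag' - u) = (1 - a) * (H u \<bullet> (ag - u)) + a * (H u \<bullet> (w - u))"
    by (simp add: inner_add_right)
  have "gap G H J ag' u \<le> (1 - a) * gap G H J ag u
      + a * (J w - J u + (H u + gradG md) \<bullet> (w - u) + L_G * a / 2 * d\<^sup>2)"
    unfolding gap_def H1 inner_add_left
    using G5 J1 by (simp add: algebra_simps power2_eq_square)
  with main show ?thesis by linarith
qed

section \<open>Summation over the iterations\<close>

theorem corollary2p2:
  fixes N :: "'a::euclidean_space \<Rightarrow> real"
    and Z :: "'a set"
    and G J \<omega> :: "'a \<Rightarrow> real"
    and gradG H grad\<omega> :: "'a \<Rightarrow> 'a"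
    and L_G L_H \<mu> \<Omega>_Z :: real
    and \<alpha> \<gamma> :: "nat \<Rightarrow> real"
    and r w w_md w_ag :: "nat \<Rightarrow> 'a"
  assumes N: "is_norm N"
    and Z: "Z \<noteq> {}" "closed Z" "convex Z"
    and G_C1: "has_gradient_on G gradG Z" "continuous_on Z gradG"
    and G_bounds: "\<And>x v. x \<in> Z \<Longrightarrow> v \<in> Z \<Longrightarrow>
          0 \<le> G x - G v - gradG v \<bullet> (x - v) \<and>
          G x - G v - gradG v \<bullet> (x - v) \<le> L_G / 2 * (N (x - v))\<^sup>2"
    and H_mono: "\<And>x v. x \<in> Z \<Longrightarrow> v \<in> Z \<Longrightarrow> 0 \<le> (H x - H v) \<bullet> (x - v)"
    and H_Lipschitz: "\<And>x v. x \<in> Z \<Longrightarrow> v \<in> Z \<Longrightarrow> dual_norm N (H x - H v) \<le> L_H * N (x - v)"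
    and J_convex: "convex_on Z J"
    and J_subgradient: "\<And>u. u \<in> Z \<Longrightarrow> subdifferential Z J u \<noteq> {}"
    and \<omega>_diff: "has_gradient_on \<omega> grad\<omega> Z"
    and \<mu>: "0 < \<mu>"
    and \<omega>_strongly_convex: "strongly_convex_on N \<mu> Z \<omega>"
    and prox_wd: "prox_well_defined Z \<omega> grad\<omega> J"
    and L: "0 \<le> L_G" "0 \<le> L_H" "0 < L_G + L_H"
    and V_bound: "(SUP (z1, z2)\<in>Z \<times> Z. ereal (bregman \<omega> grad\<omega> z1 z2)) \<le> ereal (\<Omega>_Z\<^sup>2)"
    and alpha: "\<And>t. t \<ge> 1 \<Longrightarrow> \<alpha> t = 2 / (real t + 1)"
    and gamma: "\<And>t. t \<ge> 1 \<Longrightarrow> \<gamma> t = \<mu> * real t / (2 * (L_G + L_H * real t))"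
    and amp: "amp_method Z gradG H J \<omega> grad\<omega> \<alpha> \<gamma> r w w_md w_ag"
  shows "\<forall>t\<ge>1. \<forall>u\<in>Z.
           gap G H J (w_ag (t + 1)) u
             \<le> (4 * L_G / (\<mu> * real t * (real t + 1)) + 4 * L_H / (\<mu> * real t)) * \<Omega>_Z\<^sup>2"
proof (intro allI impI ballI)
  fix t :: nat and u
  assume t: "1 \<le> t" and u: "u \<in> Z"
  let ?V = "\<lambda>n. bregman \<omega> grad\<omega> (r n) u"
  have den: "0 < L_G + L_H * real n" if "1 \<le> n" for n
  proof -
    have "L_H \<le> L_H * real n" using that L(2) by (simp add: mult_le_cancel_left1)
    then show ?thesis using L by linarith
  qed
  have \<gamma>: "0 < \<gamma> n" if "1 \<le> n" for n
    unfolding gamma[OF that] using den[OF that] \<mu> that by simp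
  have \<alpha>: "0 \<le> \<alpha> n" "\<alpha> n \<le> 1" if "1 \<le> n" for n
    unfolding alpha[OF that] using that by simp_all
  have in_Z: "r n \<in> Z \<and> w_ag n \<in> Z" if "1 \<le> n" for n
    using that
  proof (induction n rule: dec_induct)
    case base
    then show ?case using amp unfolding amp_method_def by auto
  next
    case (step n)
    then have "w (n + 1) \<in> Z" "r (n + 1) \<in> Z"
      using amp prox_in[OF prox_wd _ \<gamma>] unfolding amp_method_def by auto
    moreover have "w_ag (n + 1) = (1 - \<alpha> n) *\<^sub>R w_ag n + \<alpha> n *\<^sub>R w (n + 1)"
      using amp step(1) unfolding amp_method_def by blast
    ultimately show ?case using step \<alpha>[of n] Z(3) by (auto intro: convexD)
  qed
  \<comment> \<open>With \<open>D\<close> the common denominator, \<open>L_G / D\<close> and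
    \<open>L_H * n / D\<close> are nonnegative and sum to 1. Each summand on the left is at most
    \<open>\<mu>\<close> times its fraction; for the second, a number in [0,1] dominates its
    square.\<close>
  have stepsize: "L_G * \<alpha> n * \<gamma> n + L_H\<^sup>2 * (\<gamma> n)\<^sup>2 / \<mu> \<le> \<mu>" if n: "1 \<le> n" for n
  proof -
    define D where "D = L_G + L_H * real n"
    have D: "0 < D" unfolding D_def by (rule den[OF n])
    have p: "0 \<le> L_G / D" "0 \<le> L_H * n / D" using D L by simp_all
    have s: "L_G / D + L_H * n / D = 1"
      using D unfolding D_def by (simp add: add_divide_distrib[symmetric])
    have "L_G * \<alpha> n * \<gamma> n = \<mu> * (L_G / D * (n / (real n + 1)))"
      unfolding alpha[OF n] gamma[OF n] D_def[symmetric] using D n by (simp add: field_simps)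
    also have "\<dots> \<le> \<mu> * (L_G / D * 1)"
      using p \<mu> by (intro mult_left_mono) simp_all
    finally have 1: "L_G * \<alpha> n * \<gamma> n \<le> \<mu> * (L_G / D)" by simp
    have "L_H\<^sup>2 * (\<gamma> n)\<^sup>2 / \<mu> = \<mu> * ((L_H * n / D)\<^sup>2 / 4)"
      unfolding gamma[OF n] D_def[symmetric] using D \<mu> by (simp add: field_simps power2_eq_square)
    also have "\<dots> \<le> \<mu> * (L_H * n / D)"
    proof -
      have "(L_H * n / D)\<^sup>2 \<le> L_H * n / D"
        using p s power_le_one_iff mult_left_le[of "L_H * n / D" "L_H * n / D"]
        by (simp add: power2_eq_square)
      then show ?thesis using p(2) \<mu> by (intro mult_left_mono) linarith+
    qed
    finally have "L_G * \<alpha> n * \<gamma> n + L_H\<^sup>2 * (\<gamma> n)\<^sup>2 / \<mu> \<le> \<mu> * (L_G / D + L_H * n / D)"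
      using 1 by (simp add: distrib_left)
    then show ?thesis unfolding s by simp
  qed
  \<comment> \<open>The weight is chosen so that multiplying by \<open>1 - \<alpha> n\<close> gives
    the weight of index \<open>n - 1\<close>. For \<open>n = 1\<close> that weight is 0, so the gap
    at the starting point never enters.\<close>
  have weighted: "real n * (real n + 1) / 2 * gap G H J (w_ag (n + 1)) u
      \<le> real n * (real n - 1) / 2 * gap G H J (w_ag n) u
        + 2 * (L_G + L_H * real n) / \<mu> * (?V n - ?V (n + 1))" if n: "1 \<le> n" for n
  proof -
    have iter: "w_md n = (1 - \<alpha> n) *\<^sub>R w_ag n + \<alpha> n *\<^sub>R r n"
      "w (n + 1) = prox Z \<omega> grad\<omega> J (\<gamma> n) (r n) (\<gamma> n *\<^sub>R H (r n) + \<gamma> n *\<^sub>R gradG (w_md n))"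
      "r (n + 1) = prox Z \<omega> grad\<omega> J (\<gamma> n) (r n) (\<gamma> n *\<^sub>R H (w (n + 1)) + \<gamma> n *\<^sub>R gradG (w_md n))"
      "w_ag (n + 1) = (1 - \<alpha> n) *\<^sub>R w_ag n + \<alpha> n *\<^sub>R w (n + 1)"
      using amp n unfolding amp_method_def by blast+
    have "gap G H J (w_ag (n + 1)) u
        \<le> (1 - \<alpha> n) * gap G H J (w_ag n) u + \<alpha> n / \<gamma> n * (?V n - ?V (n + 1))"
      by (rule gap_step[where G = G and gradG = gradG and H = H, OF N Z(3) J_convex \<omega>_diff
            \<omega>_strongly_convex prox_wd \<mu> \<gamma>[OF n] \<alpha>[OF n] stepsize[OF n] in_Z[OF n, THEN conjunct1] in_Z[OF n, THEN conjunct2] u iter])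
        (fact G_bounds H_mono H_Lipschitz)+
    then have "real n * (real n + 1) / 2 * gap G H J (w_ag (n + 1)) u
        \<le> real n * (real n + 1) / 2 *
          ((1 - \<alpha> n) * gap G H J (w_ag n) u + \<alpha> n / \<gamma> n * (?V n - ?V (n + 1)))"
      by (intro mult_left_mono) simp_all
    also have "\<dots> = real n * (real n + 1) / 2 * (1 - \<alpha> n) * gap G H J (w_ag n) u
        + real n * (real n + 1) / 2 * (\<alpha> n / \<gamma> n) * (?V n - ?V (n + 1))"
      by (simp only: distrib_left mult.assoc)
    also have "real n * (real n + 1) / 2 * (1 - \<alpha> n) = real n * (real n - 1) / 2"
      unfolding alpha[OF n] by (simp add: field_simps)
    also have "real n * (real n + 1) / 2 * (\<alpha> n / \<gamma> n) = 2 * (L_G + L_H * real n) / \<mu>"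
      unfolding alpha[OF n] gamma[OF n] using \<mu> n den[OF n] by (simp add: divide_simps)
    finally show ?thesis .
  qed
  \<comment> \<open>The supremum is taken in \<open>ereal\<close>, where it bounds every member of
    the family unconditionally.\<close>
  have V_le: "?V n \<le> \<Omega>_Z\<^sup>2" if "1 \<le> n" for n
  proof -
    have "ereal (?V n) \<le> (SUP (z1, z2)\<in>Z \<times> Z. ereal (bregman \<omega> grad\<omega> z1 z2))"
      using in_Z[OF that] u by (intro SUP_upper2[of "(r n, u)"]) auto
    with V_bound have "ereal (?V n) \<le> ereal (\<Omega>_Z\<^sup>2)" by (rule order_trans[rotated])
    then show ?thesis by simp
  qed
  \<comment> \<open>The term \<open>- ?V (t + 1)\<close> is kept for the induction. Since
    \<open>\<Omega>_Z\<^sup>2 - ?V (n + 1)\<close> is nonnegative, its coefficient may be raised to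
    that of index \<open>n + 1\<close>, after which \<open>?V (n + 1)\<close> cancels.\<close>
  have "real t * (real t + 1) / 2 * gap G H J (w_ag (t + 1)) u
      \<le> 2 * (L_G + L_H * real t) / \<mu> * (\<Omega>_Z\<^sup>2 - ?V (t + 1))"
    using t
  proof (induction t rule: dec_induct)
    case base
    have "2 * (L_G + L_H) / \<mu> * (?V 1 - ?V 2) \<le> 2 * (L_G + L_H) / \<mu> * (\<Omega>_Z\<^sup>2 - ?V 2)"
      using L \<mu> V_le[of 1] by (intro mult_left_mono) simp_all
    then show ?case using weighted[of 1] by (simp add: numeral_2_eq_2)
  next
    case (step n)
    let ?\<beta> = "\<lambda>n. 2 * (L_G + L_H * real n) / \<mu>"
    have "?\<beta> n * (\<Omega>_Z\<^sup>2 - ?V (n + 1)) \<le> ?\<beta> (n + 1) * (\<Omega>_Z\<^sup>2 - ?V (n + 1))"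
      using V_le[of "n + 1"] L \<mu>
      by (intro mult_right_mono divide_right_mono mult_left_mono add_left_mono) simp_all
    moreover have "real (n + 1) * (real (n + 1) - 1) / 2 = real n * (real n + 1) / 2" by simp
    note weighted[of "n + 1", unfolded this]
    ultimately have "real (n + 1) * (real (n + 1) + 1) / 2 * gap G H J (w_ag (n + 1 + 1)) u
        \<le> ?\<beta> (n + 1) * (\<Omega>_Z\<^sup>2 - ?V (n + 1)) + ?\<beta> (n + 1) * (?V (n + 1) - ?V (n + 1 + 1))"
      using step.IH by linarith
    also have "\<dots> = ?\<beta> (n + 1) * (\<Omega>_Z\<^sup>2 - ?V (n + 1 + 1))"
      by (simp only: distrib_left[symmetric]) simp
    finally show ?case by simp
  qed
  also have "\<dots> \<le> 2 * (L_G + L_H * real t) / \<mu> * \<Omega>_Z\<^sup>2"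
  proof (intro mult_left_mono)
    have "0 \<le> \<mu> / 2 * (N (r (t + 1) - u))\<^sup>2" using \<mu> by simp
    also have "\<dots> \<le> ?V (t + 1)"
      using in_Z[of "t + 1"] u by (intro bregman_lower_bound[OF \<omega>_diff \<omega>_strongly_convex]) auto
    finally show "\<Omega>_Z\<^sup>2 - ?V (t + 1) \<le> \<Omega>_Z\<^sup>2" by simp
  qed (use den[OF t] \<mu> in simp)
  finally have "gap G H J (w_ag (t + 1)) u
      \<le> 2 * (L_G + L_H * real t) / \<mu> * \<Omega>_Z\<^sup>2 / (real t * (real t + 1) / 2)"
    using t by (subst pos_le_divide_eq) (simp_all add: mult.commute)
  also have "\<dots> = (4 * L_G / (\<mu> * real t * (real t + 1)) + 4 * L_H / (\<mu> * (real t + 1))) * \<Omega>_Z\<^sup>2"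
    using t \<mu> by (simp add: divide_simps) (simp add: algebra_simps)
  \<comment> \<open>The computation gives the slightly sharper denominator
    \<open>\<mu> * (real t + 1)\<close> under \<open>L_H\<close>, which is relaxed here to the
    stated one.\<close>
  also have "\<dots> \<le> (4 * L_G / (\<mu> * real t * (real t + 1)) + 4 * L_H / (\<mu> * real t)) * \<Omega>_Z\<^sup>2"
    using t \<mu> L by (intro mult_right_mono add_left_mono divide_left_mono) simp_all
  finally show "gap G H J (w_ag (t + 1)) u
      \<le> (4 * L_G / (\<mu> * real t * (real t + 1)) + 4 * L_H / (\<mu> * real t)) * \<Omega>_Z\<^sup>2" .
qed

end
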